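(* Let $\mathcal{H}_{\mathrm{s}}$ and $\mathcal{H}_{\mathrm{e}}$ be finite-dimensional complex Hilbert spaces, let $\mathcal{H}_{\mathrm{c}} = \mathcal{H}_{\mathrm{s}} \otimes \mathcal{H}_{\mathrm{e}}$, and let $U, V \in \mathrm{U}(\mathcal{H}_{\mathrm{c}})$. Then $\mathrm{Tr}_{\mathrm{e}}(U \rho U^{\dagger}) = \mathrm{Tr}_{\mathrm{e}}(V \rho V^{\dagger})$ for all density matrices $\rho \in \mathcal{D}(\mathcal{H}_{\mathrm{c}})$ if and only if $U = (\mathbb{1}_{\mathrm{s}} \otimes \Phi) V$ for some $\Phi \in \mathrm{U}(\mathcal{H}_{\mathrm{e}})$.
   Context: For a finite-dimensional complex Hilbert space $\mathcal{H}$, $\mathrm{U}(\mathcal{H})$ is the group of unitary operators on $\mathcal{H}$, and $\mathcal{D}(\mathcal{H})$ is the set of density matrices on $\mathcal{H}$, i.e. positive semidefinite operators $\rho$ with $\mathrm{Tr}(\rho) = 1$. $\mathbb{1}_{\mathrm{s}}$ is the identity operator on $\mathcal{H}_{\mathrm{s}}$. $\mathrm{Tr}_{\mathrm{e}}$ denotes the partial trace over $\mathcal{H}_{\mathrm{e}}$, the linear map from operators on $\mathcal{H}_{\mathrm{s}} \otimes \mathcal{H}_{\mathrm{e}}$ to operators on $\mathcal{H}_{\mathrm{s}}$ with $\mathrm{Tr}_{\mathrm{e}}(A \otimes B) = \mathrm{Tr}(B) A$. *)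

theory Defs
  imports "Jordan_Normal_Form.Schur_Decomposition"
begin

text \<open>
  A finite-dimensional complex Hilbert space is given by its dimension \<open>d\<close> through a choice of
  orthonormal basis; operators on it are the elements of \<open>carrier_mat d d\<close>. The dimension 0 is
  admitted. The tensor product of spaces of dimensions \<open>m\<close> and \<open>n\<close> has dimension \<open>m * n\<close>, and the
  product basis vector with index pair \<open>(i, k)\<close>, \<open>i < m\<close>, \<open>k < n\<close>, has index \<open>i * n + k\<close>.
\<close>

definition unitary_mats :: "nat \<Rightarrow> complex mat set" where
  "unitary_mats d = {U \<in> carrier_mat d d.
     mat_adjoint U * U = 1\<^sub>m d \<and> U * mat_adjoint U = 1\<^sub>m d}"

text \<open>
  In the order on \<open>complex\<close>, \<open>0 \<le> z\<close> means that \<open>z\<close> is real and nonnegative; hence positive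
  semidefiniteness as defined here entails that the matrix is Hermitian.
\<close>

definition psd_mat :: "complex mat \<Rightarrow> bool" where
  "psd_mat A \<longleftrightarrow> A \<in> carrier_mat (dim_row A) (dim_row A) \<and>
     (\<forall>v \<in> carrier_vec (dim_row A). 0 \<le> (A *\<^sub>v v) \<bullet>c v)"

definition mat_trace :: "complex mat \<Rightarrow> complex" where
  "mat_trace A = (\<Sum>i < dim_row A. A $$ (i, i))"

definition density_mats :: "nat \<Rightarrow> complex mat set" where
  "density_mats d = {\<rho> \<in> carrier_mat d d. psd_mat \<rho> \<and> mat_trace \<rho> = 1}"

definition tensor_mat :: "complex mat \<Rightarrow> complex mat \<Rightarrow> complex mat" (infixl "\<Otimes>" 68) where
  "A \<Otimes> B = mat (dim_row A * dim_row B) (dim_col A * dim_col B)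
     (\<lambda>(r, c). A $$ (r div dim_row B, c div dim_col B) * B $$ (r mod dim_row B, c mod dim_col B))"

text \<open>
  The partial trace over the second factor. By the lemmas below it is linear and maps
  \<open>A \<Otimes> B\<close> to \<open>mat_trace B \<cdot>\<^sub>m A\<close>; as the products of matrix units span
  \<open>carrier_mat (m * n) (m * n)\<close>, this determines it.
\<close>

definition partial_trace :: "nat \<Rightarrow> nat \<Rightarrow> complex mat \<Rightarrow> complex mat" where
  "partial_trace m n X = mat m m (\<lambda>(i, j). \<Sum>k < n. X $$ (i * n + k, j * n + k))"

lemma tensor_index_less: "i < m \<Longrightarrow> k < n \<Longrightarrow> i * n + k < m * (n::nat)"
proof -
  assume "i < m" "k < n"
  then have "i * n + k < Suc i * n" by simp
  also have "\<dots> \<le> m * n" using \<open>i < m\<close> by (intro mult_le_mono1) simp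
  finally show ?thesis .
qed

lemma tensor_mat_index:
  assumes "A \<in> carrier_mat m m'" "B \<in> carrier_mat n n'"
    and "i < m" "j < m'" "k < n" "l < n'"
  shows "(A \<Otimes> B) $$ (i * n + k, j * n' + l) = A $$ (i, j) * B $$ (k, l)"
  using assms tensor_index_less[of i m k n] tensor_index_less[of j m' l n']
  by (auto simp: tensor_mat_def)

lemma partial_trace_add:
  assumes "X \<in> carrier_mat (m * n) (m * n)" "Y \<in> carrier_mat (m * n) (m * n)"
  shows "partial_trace m n (X + Y) = partial_trace m n X + partial_trace m n Y"
  using assms by (intro eq_matI) (auto simp: partial_trace_def tensor_index_less sum.distrib)

lemma partial_trace_smult:
  assumes "X \<in> carrier_mat (m * n) (m * n)"
  shows "partial_trace m n (c \<cdot>\<^sub>m X) = c \<cdot>\<^sub>m partial_trace m n X"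
  using assms by (intro eq_matI) (auto simp: partial_trace_def tensor_index_less sum_distrib_left)

lemma partial_trace_tensor:
  assumes "A \<in> carrier_mat m m" "B \<in> carrier_mat n n"
  shows "partial_trace m n (A \<Otimes> B) = mat_trace B \<cdot>\<^sub>m A"
  using assms
  by (intro eq_matI)
     (auto simp: partial_trace_def mat_trace_def tensor_mat_index[OF assms] sum_distrib_left
       mult.commute)

end

theory Submission
  imports Defs
begin

text \<open>
  If \<open>U = (\<one> \<otimes> \<Phi>) V\<close>, then \<open>\<Phi>\<close> cancels because the partial trace is cyclic with respect to
  operators of the form \<open>\<one> \<otimes> \<Phi>\<close>. Conversely, multiples of density matrices include all \<open>v v\<^sup>\<dagger>\<close>,
  so by polarization the hypothesis extends to all \<open>u v\<^sup>\<dagger>\<close>. Choosing \<open>u = V\<^sup>\<dagger> e\<^sub>p\<close> and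
  \<open>v = V\<^sup>\<dagger> e\<^sub>q\<close> shows that conjugation by \<open>W = U V\<^sup>\<dagger>\<close> preserves the partial traces of all
  matrix units \<open>e\<^sub>p e\<^sub>q\<^sup>\<dagger>\<close>. Entry by entry, this forces \<open>W\<close> to be block diagonal with equal
  unitary blocks.
\<close>

section \<open>Entries and products of adjoints\<close>

lemma mat_adjoint_dim [simp]:
  "dim_row (mat_adjoint A) = dim_col A" "dim_col (mat_adjoint A) = dim_row A"
  by (auto simp: mat_adjoint_def)

lemma mat_adjoint_carrier [simp]:
  "A \<in> carrier_mat m n \<Longrightarrow> mat_adjoint A \<in> carrier_mat n m"
  by (auto simp: mat_adjoint_def)

lemma mat_adjoint_index [simp]:
  fixes A :: "complex mat"
  shows "i < dim_col A \<Longrightarrow> j < dim_row A \<Longrightarrow> mat_adjoint A $$ (i, j) = cnj (A $$ (j, i))"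
  by (auto simp: mat_adjoint_def mat_of_rows_def)

lemma mat_adjoint_mult:
  fixes A B :: "complex mat"
  assumes "A \<in> carrier_mat m n" "B \<in> carrier_mat n p"
  shows "mat_adjoint (A * B) = mat_adjoint B * mat_adjoint A"
proof (rule eq_matI)
  show "dim_row (mat_adjoint (A * B)) = dim_row (mat_adjoint B * mat_adjoint A)"
    "dim_col (mat_adjoint (A * B)) = dim_col (mat_adjoint B * mat_adjoint A)"
    using assms by (auto simp: mat_adjoint_def)
  fix i j
  assume "i < dim_row (mat_adjoint B * mat_adjoint A)" "j < dim_col (mat_adjoint B * mat_adjoint A)"
  then have "i < p" "j < m"
    using assms by (auto simp: mat_adjoint_def)
  then show "mat_adjoint (A * B) $$ (i, j) = (mat_adjoint B * mat_adjoint A) $$ (i, j)"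
    using assms by (auto simp: scalar_prod_def mult.commute intro!: sum.cong)
qed

section \<open>Indices of the product basis\<close>

lemma sum_prod_index:
  fixes f :: "nat \<Rightarrow> 'a :: comm_monoid_add"
  shows "(\<Sum>r<m * n. f r) = (\<Sum>i<m. \<Sum>k<n. f (i * n + k))"
proof -
  have "sum f {i * n..<i * n + n} = (\<Sum>k<n. f (i * n + k))" for i
    using sum.shift_bounds_nat_ivl[of f 0 "i * n" n]
    by (simp add: add.commute atLeast0LessThan)
  then show ?thesis
    by (simp add: sum.nat_group[of f n m, symmetric])
qed

lemma tensor_index_eq_iff:
  assumes "k < n" "l < (n::nat)"
  shows "i * n + k = a * n + l \<longleftrightarrow> i = a \<and> k = l"
  using assms by (metis div_mult_self3 div_less add.right_neutral mod_mult_self3 mod_less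
      not_less_zero)

lemma tensor_index_cases:
  assumes "r < m * n"
  obtains i k where "r = i * n + k" "i < m" "k < (n::nat)"
proof
  \<comment> \<open>The bound \<open>r < m * n\<close> excludes \<open>n = 0\<close>, for which
    \<open>r mod n\<close> would be \<open>r\<close> itself.\<close>
  have "0 < n" using assms by (cases n) auto
  then show "r div n < m" "r mod n < n"
    using assms by (auto simp: less_mult_imp_div_less)
qed simp

text \<open>Every index below \<open>m * n\<close> splits into a pair, so equality need only be
  tested at split indices, where \<open>tensor_mat_index\<close> applies.\<close>

lemma mat_eq_tensorI:
  assumes "A \<in> carrier_mat (m * n) (m' * n')" "B \<in> carrier_mat (m * n) (m' * n')"
    and "\<And>i k j l. i < m \<Longrightarrow> k < n \<Longrightarrow> j < m' \<Longrightarrow> l < n' \<Longrightarrow>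
      A $$ (i * n + k, j * n' + l) = B $$ (i * n + k, j * n' + l)"
  shows "A = B"
proof (rule eq_matI)
  fix r c
  assume "r < dim_row B" "c < dim_col B"
  then have "r < m * n" "c < m' * n'" using assms by auto
  then show "A $$ (r, c) = B $$ (r, c)"
    by (metis tensor_index_cases assms(3))
qed (use assms in auto)

section \<open>Operators \<open>1 \<otimes> \<Phi>\<close> and the partial trace\<close>

lemma tensor_mat_dim [simp]:
  "dim_row (A \<Otimes> B) = dim_row A * dim_row B" "dim_col (A \<Otimes> B) = dim_col A * dim_col B"
  by (auto simp: tensor_mat_def)

lemma tensor_mat_carrier [simp]:
  "A \<in> carrier_mat m m' \<Longrightarrow> B \<in> carrier_mat n n' \<Longrightarrow> A \<Otimes> B \<in> carrier_mat (m * n) (m' * n')"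
  by (auto simp: tensor_mat_def)

text \<open>The identity factor annihilates every block except \<open>j = i\<close>, so the sum over
  \<open>m * n\<close> indices collapses to one over \<open>n\<close>.\<close>

lemma one_tensor_mult_index:
  assumes "\<Phi> \<in> carrier_mat n n" "X \<in> carrier_mat (m * n) p" "i < m" "k < n" "c < p"
  shows "((1\<^sub>m m \<Otimes> \<Phi>) * X) $$ (i * n + k, c) = (\<Sum>l<n. \<Phi> $$ (k, l) * X $$ (i * n + l, c))"
proof -
  have "((1\<^sub>m m \<Otimes> \<Phi>) * X) $$ (i * n + k, c)
      = (\<Sum>r<m * n. (1\<^sub>m m \<Otimes> \<Phi>) $$ (i * n + k, r) * X $$ (r, c))"
    using assms tensor_index_less[of i m k n]
    by (auto simp: scalar_prod_def atLeast0LessThan intro!: sum.cong)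
  also have "\<dots> = (\<Sum>j<m. \<Sum>l<n. 1\<^sub>m m $$ (i, j) * \<Phi> $$ (k, l) * X $$ (j * n + l, c))"
    using assms by (simp add: sum_prod_index tensor_mat_index[OF one_carrier_mat assms(1)])
  also have "\<dots> = (\<Sum>j<m. if j = i then \<Sum>l<n. \<Phi> $$ (k, l) * X $$ (j * n + l, c) else 0)"
    using assms by (intro sum.cong) auto
  finally show ?thesis using assms by simp
qed

lemma mult_one_tensor_index:
  assumes "\<Phi> \<in> carrier_mat n n" "X \<in> carrier_mat p (m * n)" "j < m" "k < n" "c < p"
  shows "(X * (1\<^sub>m m \<Otimes> \<Phi>)) $$ (c, j * n + k) = (\<Sum>l<n. X $$ (c, j * n + l) * \<Phi> $$ (l, k))"
proof -
  have "(X * (1\<^sub>m m \<Otimes> \<Phi>)) $$ (c, j * n + k)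
      = (\<Sum>r<m * n. X $$ (c, r) * (1\<^sub>m m \<Otimes> \<Phi>) $$ (r, j * n + k))"
    using assms tensor_index_less[of j m k n]
    by (auto simp: scalar_prod_def atLeast0LessThan intro!: sum.cong)
  also have "\<dots> = (\<Sum>i<m. \<Sum>l<n. X $$ (c, i * n + l) * (1\<^sub>m m $$ (i, j) * \<Phi> $$ (l, k)))"
    using assms by (simp add: sum_prod_index tensor_mat_index[OF one_carrier_mat assms(1)])
  also have "\<dots> = (\<Sum>i<m. if i = j then \<Sum>l<n. X $$ (c, i * n + l) * \<Phi> $$ (l, k) else 0)"
    using assms by (intro sum.cong) auto
  finally show ?thesis using assms by simp
qed

text \<open>As \<open>1 \<otimes> \<Phi>\<close> leaves the first index fixed, entry
  \<open>(i, j)\<close> of either side is a double sum over second indices only; the two differ in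
  the order of summation.\<close>

lemma partial_trace_cyclic:
  assumes "\<Phi> \<in> carrier_mat n n" "X \<in> carrier_mat (m * n) (m * n)"
  shows "partial_trace m n ((1\<^sub>m m \<Otimes> \<Phi>) * X) = partial_trace m n (X * (1\<^sub>m m \<Otimes> \<Phi>))"
proof (rule eq_matI)
  fix i j
  assume "i < dim_row (partial_trace m n (X * (1\<^sub>m m \<Otimes> \<Phi>)))"
    "j < dim_col (partial_trace m n (X * (1\<^sub>m m \<Otimes> \<Phi>)))"
  then have ij: "i < m" "j < m" by (auto simp: partial_trace_def)
  have "(\<Sum>k<n. \<Sum>l<n. \<Phi> $$ (k, l) * X $$ (i * n + l, j * n + k))
      = (\<Sum>k<n. \<Sum>l<n. X $$ (i * n + k, j * n + l) * \<Phi> $$ (l, k))"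
    by (subst sum.swap) (simp add: mult.commute)
  then show "partial_trace m n ((1\<^sub>m m \<Otimes> \<Phi>) * X) $$ (i, j)
      = partial_trace m n (X * (1\<^sub>m m \<Otimes> \<Phi>)) $$ (i, j)"
    using ij by (simp add: partial_trace_def tensor_index_less
        one_tensor_mult_index[OF assms] mult_one_tensor_index[OF assms])
qed (auto simp: partial_trace_def)

lemma mat_adjoint_one_tensor:
  assumes "\<Phi> \<in> carrier_mat n n"
  shows "mat_adjoint (1\<^sub>m m \<Otimes> \<Phi>) = 1\<^sub>m m \<Otimes> mat_adjoint \<Phi>"
proof (rule mat_eq_tensorI)
  show "mat_adjoint (1\<^sub>m m \<Otimes> \<Phi>) \<in> carrier_mat (m * n) (m * n)"
    "1\<^sub>m m \<Otimes> mat_adjoint \<Phi> \<in> carrier_mat (m * n) (m * n)"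
    using assms by simp_all
  have "1\<^sub>m m \<Otimes> \<Phi> \<in> carrier_mat (m * n) (m * n)"
    using assms by simp
  then show "mat_adjoint (1\<^sub>m m \<Otimes> \<Phi>) $$ (i * n + k, j * n + l)
      = (1\<^sub>m m \<Otimes> mat_adjoint \<Phi>) $$ (i * n + k, j * n + l)"
    if "i < m" "k < n" "j < m" "l < n" for i k j l
    using that assms tensor_mat_index[OF one_carrier_mat assms, of j m i l k]
      tensor_mat_index[OF one_carrier_mat mat_adjoint_carrier[OF assms], of i m j k l]
    by (auto simp: tensor_index_less)
qed

lemma one_tensor_mult:
  assumes "\<Phi> \<in> carrier_mat n n" "\<Psi> \<in> carrier_mat n n"
  shows "(1\<^sub>m m \<Otimes> \<Phi>) * (1\<^sub>m m \<Otimes> \<Psi>) = 1\<^sub>m m \<Otimes> (\<Phi> * \<Psi>)"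
proof (rule mat_eq_tensorI)
  have c: "1\<^sub>m m \<Otimes> \<Phi> \<in> carrier_mat (m * n) (m * n)" "1\<^sub>m m \<Otimes> \<Psi> \<in> carrier_mat (m * n) (m * n)"
    "\<Phi> * \<Psi> \<in> carrier_mat n n"
    using assms by simp_all
  then show "(1\<^sub>m m \<Otimes> \<Phi>) * (1\<^sub>m m \<Otimes> \<Psi>) \<in> carrier_mat (m * n) (m * n)"
    "1\<^sub>m m \<Otimes> (\<Phi> * \<Psi>) \<in> carrier_mat (m * n) (m * n)"
    by simp_all
  show "((1\<^sub>m m \<Otimes> \<Phi>) * (1\<^sub>m m \<Otimes> \<Psi>)) $$ (i * n + k, j * n + l)
      = (1\<^sub>m m \<Otimes> (\<Phi> * \<Psi>)) $$ (i * n + k, j * n + l)"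
    if "i < m" "k < n" "j < m" "l < n" for i k j l
    unfolding one_tensor_mult_index[OF assms(1) c(2) that(1,2) tensor_index_less[OF that(3,4)]]
    using that assms
    by (auto simp: scalar_prod_def atLeast0LessThan
        tensor_mat_index[OF one_carrier_mat assms(2)] tensor_mat_index[OF one_carrier_mat c(3)])
qed

lemma one_tensor_one: "1\<^sub>m m \<Otimes> 1\<^sub>m n = (1\<^sub>m (m * n) :: complex mat)"
proof (rule mat_eq_tensorI)
  show "1\<^sub>m m \<Otimes> 1\<^sub>m n \<in> carrier_mat (m * n) (m * n)"
    by simp
  show "(1\<^sub>m m \<Otimes> 1\<^sub>m n) $$ (i * n + k, j * n + l) = (1\<^sub>m (m * n) :: complex mat) $$ (i * n + k, j * n + l)"
    if "i < m" "k < n" "j < m" "l < n" for i k j l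
    using that by (auto simp: tensor_mat_index[OF one_carrier_mat one_carrier_mat]
        tensor_index_less tensor_index_eq_iff)
qed simp

text \<open>Cyclicity carries \<open>1 \<otimes> \<Phi>\<close> to the right of its adjoint, where
  \<open>\<Phi>\<^sup>\<dagger> \<Phi> = 1\<close> cancels both.\<close>

lemma partial_trace_one_tensor_conj:
  assumes "\<Phi> \<in> unitary_mats n" and X: "X \<in> carrier_mat (m * n) (m * n)"
  shows "partial_trace m n ((1\<^sub>m m \<Otimes> \<Phi>) * X * mat_adjoint (1\<^sub>m m \<Otimes> \<Phi>)) = partial_trace m n X"
proof -
  have \<Phi>: "\<Phi> \<in> carrier_mat n n" and unit: "mat_adjoint \<Phi> * \<Phi> = 1\<^sub>m n"
    using assms by (auto simp: unitary_mats_def)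
  define T where "T = 1\<^sub>m m \<Otimes> \<Phi>"
  define T' where "T' = 1\<^sub>m m \<Otimes> mat_adjoint \<Phi>"
  have T: "T \<in> carrier_mat (m * n) (m * n)" "T' \<in> carrier_mat (m * n) (m * n)"
    using \<Phi> by (simp_all add: T_def T'_def)
  have "T' * T = 1\<^sub>m (m * n)"
    using one_tensor_mult[of "mat_adjoint \<Phi>" n \<Phi> m] \<Phi> unit
    by (simp add: one_tensor_one T_def T'_def)
  moreover have "partial_trace m n (T * (X * T')) = partial_trace m n (X * T' * T)"
    unfolding T_def using T by (intro partial_trace_cyclic[OF \<Phi>] mult_carrier_mat[OF X])
  ultimately have "partial_trace m n (T * X * T') = partial_trace m n X"
    using T X by (simp add: assoc_mult_mat[of _ "m * n" "m * n" _ "m * n" _ "m * n"])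
  then show ?thesis
    by (simp add: T_def T'_def mat_adjoint_one_tensor[OF \<Phi>])
qed

section \<open>Operators \<open>u v\<^sup>\<dagger>\<close>: positivity, normalization and
  polarization\<close>

definition outer_prod :: "complex vec \<Rightarrow> complex vec \<Rightarrow> complex mat" where
  "outer_prod u v = mat (dim_vec u) (dim_vec v) (\<lambda>(i, j). u $ i * cnj (v $ j))"

lemma outer_prod_carrier [simp]:
  "u \<in> carrier_vec m \<Longrightarrow> v \<in> carrier_vec n \<Longrightarrow> outer_prod u v \<in> carrier_mat m n"
  by (auto simp: outer_prod_def)

lemma outer_prod_conj:
  assumes "A \<in> carrier_mat m n" "u \<in> carrier_vec n" "v \<in> carrier_vec n"
  shows "A * outer_prod u v * mat_adjoint A = outer_prod (A *\<^sub>v u) (A *\<^sub>v v)"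
proof (rule eq_matI)
  fix i j
  assume "i < dim_row (outer_prod (A *\<^sub>v u) (A *\<^sub>v v))" "j < dim_col (outer_prod (A *\<^sub>v u) (A *\<^sub>v v))"
  then have ij: "i < m" "j < m" using assms by (auto simp: outer_prod_def)
  have "(A * outer_prod u v * mat_adjoint A) $$ (i, j)
      = (\<Sum>b<n. (\<Sum>a<n. A $$ (i, a) * (u $ a * cnj (v $ b))) * cnj (A $$ (j, b)))"
    using assms ij mat_adjoint_carrier[OF assms(1)]
    by (auto simp: scalar_prod_def outer_prod_def atLeast0LessThan intro!: sum.cong)
  also have "\<dots> = (\<Sum>a<n. A $$ (i, a) * u $ a) * cnj (\<Sum>b<n. A $$ (j, b) * v $ b)"
    by (simp add: sum_distrib_left sum_distrib_right mult_ac)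
  also have "\<dots> = outer_prod (A *\<^sub>v u) (A *\<^sub>v v) $$ (i, j)"
    using assms ij by (auto simp: scalar_prod_def outer_prod_def atLeast0LessThan)
  finally show "(A * outer_prod u v * mat_adjoint A) $$ (i, j)
      = outer_prod (A *\<^sub>v u) (A *\<^sub>v v) $$ (i, j)" .
qed (use assms mat_adjoint_carrier[OF assms(1)] in \<open>auto simp: outer_prod_def\<close>)

text \<open>The quadratic form at \<open>w\<close> is \<open>s * cnj s\<close>, the squared modulus
  of the inner product of \<open>v\<close> and \<open>w\<close>.\<close>

lemma psd_outer_prod: "psd_mat (outer_prod v v)"
  unfolding psd_mat_def
proof (intro conjI ballI)
  fix w :: "complex vec"
  assume "w \<in> carrier_vec (dim_row (outer_prod v v))"
  then have w: "dim_vec w = dim_vec v" by (auto simp: outer_prod_def)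
  define s where "s = (\<Sum>i<dim_vec v. v $ i * cnj (w $ i))"
  have "(outer_prod v v *\<^sub>v w) \<bullet>c w
      = (\<Sum>i<dim_vec v. (\<Sum>j<dim_vec v. v $ i * cnj (v $ j) * w $ j) * cnj (w $ i))"
    using w by (auto simp: scalar_prod_def outer_prod_def atLeast0LessThan intro!: sum.cong)
  also have "\<dots> = s * cnj s"
    unfolding s_def by (simp add: sum_distrib_left sum_distrib_right mult_ac) (rule sum.swap)
  finally show "0 \<le> (outer_prod v v *\<^sub>v w) \<bullet>c w"
    by (simp add: complex_mult_cnj less_eq_complex_def)
qed (auto simp: outer_prod_def)

lemma psd_smult:
  assumes "psd_mat A" "0 \<le> (c :: real)"
  shows "psd_mat (complex_of_real c \<cdot>\<^sub>m A)"
  unfolding psd_mat_def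
proof (intro conjI ballI)
  fix w :: "complex vec"
  assume "w \<in> carrier_vec (dim_row (complex_of_real c \<cdot>\<^sub>m A))"
  then obtain n where A: "A \<in> carrier_mat n n" and w: "w \<in> carrier_vec n"
    and p: "0 \<le> (A *\<^sub>v w) \<bullet>c w"
    using assms(1) by (auto simp: psd_mat_def)
  have "(complex_of_real c \<cdot>\<^sub>m A *\<^sub>v w) \<bullet>c w = complex_of_real c * ((A *\<^sub>v w) \<bullet>c w)"
  proof -
    have "complex_of_real c \<cdot>\<^sub>m A *\<^sub>v w = complex_of_real c \<cdot>\<^sub>v (A *\<^sub>v w)"
      using w A by (intro eq_vecI) auto
    then show ?thesis using w A by simp
  qed
  then show "0 \<le> (complex_of_real c \<cdot>\<^sub>m A *\<^sub>v w) \<bullet>c w"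
    using p assms(2) by (simp add: less_eq_complex_def)
qed (use assms(1) in \<open>auto simp: psd_mat_def\<close>)

text \<open>The trace of \<open>v v\<^sup>\<dagger>\<close> is the squared norm \<open>t\<close> of
  \<open>v\<close>. Dividing by it gives a density matrix unless \<open>v = 0\<close>, which is why
  zero is a separate case.\<close>

lemma outer_prod_self_cases:
  assumes v: "v \<in> carrier_vec d"
  obtains "outer_prod v v = 0\<^sub>m d d"
  | c \<rho> where "\<rho> \<in> density_mats d" "outer_prod v v = c \<cdot>\<^sub>m \<rho>"
proof (cases "\<forall>i<d. v $ i = 0")
  case True
  then have "outer_prod v v = 0\<^sub>m d d"
    using v by (intro eq_matI) (auto simp: outer_prod_def)
  then show ?thesis by (rule that(1))
next
  case False
  define t where "t = (\<Sum>i<d. (cmod (v $ i))\<^sup>2)"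
  from False obtain i where "i < d" "v $ i \<noteq> 0" by auto
  then have "t > 0"
    unfolding t_def by (intro sum_pos2[where i = i]) auto
  have trace: "mat_trace (outer_prod v v) = complex_of_real t"
    using v by (auto simp: mat_trace_def outer_prod_def t_def complex_norm_square simp del: of_real_power intro!: sum.cong)
  let ?\<rho> = "complex_of_real (1 / t) \<cdot>\<^sub>m outer_prod v v"
  have "mat_trace ?\<rho> = complex_of_real (1 / t) * mat_trace (outer_prod v v)"
    using v by (auto simp: mat_trace_def outer_prod_def sum_distrib_left)
  then have "?\<rho> \<in> density_mats d"
    using v \<open>t > 0\<close> psd_smult[OF psd_outer_prod, of "1 / t" v] trace
    by (auto simp: density_mats_def)
  moreover have "outer_prod v v = complex_of_real t \<cdot>\<^sub>m ?\<rho>"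
    using \<open>t > 0\<close> by (intro eq_matI) auto
  ultimately show ?thesis by (rule that(2))
qed

text \<open>The right side is the sum of \<open>(z/4) (u + z v) (u + z v)\<^sup>\<dagger>\<close>
  over the fourth roots of unity \<open>z\<close>. The coefficients of
  \<open>u u\<^sup>\<dagger>\<close>, \<open>v v\<^sup>\<dagger>\<close> and
  \<open>v u\<^sup>\<dagger>\<close> are multiples of the sums of \<open>z\<close> and of
  \<open>z\<^sup>2\<close>, which vanish, while \<open>u v\<^sup>\<dagger>\<close> picks up
  \<open>z * cnj z = 1\<close> each time.\<close>

lemma outer_prod_polarization:
  assumes "u \<in> carrier_vec d" "v \<in> carrier_vec d"
  shows "outer_prod u v =
    (1/4) \<cdot>\<^sub>m outer_prod (u + v) (u + v) + (-1/4) \<cdot>\<^sub>m outer_prod (u + (-1) \<cdot>\<^sub>v v) (u + (-1) \<cdot>\<^sub>v v) +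
    ((\<i>/4) \<cdot>\<^sub>m outer_prod (u + \<i> \<cdot>\<^sub>v v) (u + \<i> \<cdot>\<^sub>v v) +
     (-\<i>/4) \<cdot>\<^sub>m outer_prod (u + (-\<i>) \<cdot>\<^sub>v v) (u + (-\<i>) \<cdot>\<^sub>v v))"
  using assms by (intro eq_matI) (auto simp: outer_prod_def field_simps)

text \<open>Agreement of the two partial traces is a linear condition on the operator. It therefore
  passes from density matrices to all \<open>w w\<^sup>\<dagger>\<close> by scaling, and from these
  to \<open>u v\<^sup>\<dagger>\<close> by polarization.\<close>

lemma partial_trace_conj_outer_prod:
  assumes U: "U \<in> carrier_mat (m * n) (m * n)" and V: "V \<in> carrier_mat (m * n) (m * n)"
    and eq: "\<And>\<rho>. \<rho> \<in> density_mats (m * n) \<Longrightarrow>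
      partial_trace m n (U * \<rho> * mat_adjoint U) = partial_trace m n (V * \<rho> * mat_adjoint V)"
    and u: "u \<in> carrier_vec (m * n)" and v: "v \<in> carrier_vec (m * n)"
  shows "partial_trace m n (U * outer_prod u v * mat_adjoint U)
    = partial_trace m n (V * outer_prod u v * mat_adjoint V)"
proof -
  let ?d = "m * n"
  note U' = mat_adjoint_carrier[OF U] and V' = mat_adjoint_carrier[OF V]
  \<comment> \<open>\<open>S\<close> is the space of operators on which both sides agree;
    \<open>add\<close> and \<open>smult\<close> make it a linear subspace, and \<open>self\<close>
    supplies the terms of the polarization identity.\<close>
  define S where "S = {X \<in> carrier_mat ?d ?d.
    partial_trace m n (U * X * mat_adjoint U) = partial_trace m n (V * X * mat_adjoint V)}"
  have conj_add: "A * (X + Y) * mat_adjoint A = A * X * mat_adjoint A + A * Y * mat_adjoint A"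
    if "A \<in> carrier_mat ?d ?d" "X \<in> carrier_mat ?d ?d" "Y \<in> carrier_mat ?d ?d" for A X Y :: "complex mat"
    using that by (simp add: mult_add_distrib_mat[of _ ?d ?d _ ?d] add_mult_distrib_mat[of _ ?d ?d _ _ ?d])
  have conj_smult: "A * (c \<cdot>\<^sub>m X) * mat_adjoint A = c \<cdot>\<^sub>m (A * X * mat_adjoint A)"
    if "A \<in> carrier_mat ?d ?d" "X \<in> carrier_mat ?d ?d" for A X :: "complex mat" and c
    using that by (simp add: mult_smult_distrib[of _ ?d ?d _ ?d] mult_smult_assoc_mat[of _ ?d ?d _ ?d])
  have add: "X + Y \<in> S" if "X \<in> S" "Y \<in> S" for X Y
    using that U V by (auto simp: S_def conj_add partial_trace_add mult_carrier_mat[of _ ?d ?d])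
  have smult: "c \<cdot>\<^sub>m X \<in> S" if "X \<in> S" for c X
    using that U V by (auto simp: S_def conj_smult partial_trace_smult mult_carrier_mat[of _ ?d ?d])
  have self: "outer_prod w w \<in> S" if "w \<in> carrier_vec ?d" for w
  proof (rule outer_prod_self_cases[OF that])
    assume "outer_prod w w = 0\<^sub>m ?d ?d"
    then show ?thesis using U V U' V' by (simp add: S_def)
  next
    fix c \<rho>
    assume "\<rho> \<in> density_mats ?d" "outer_prod w w = c \<cdot>\<^sub>m \<rho>"
    then show ?thesis
      using smult[of \<rho> c] eq[of \<rho>] by (auto simp: S_def density_mats_def)
  qed
  have "outer_prod u v \<in> S"
    unfolding outer_prod_polarization[OF u v]
    using u v by (intro add smult self) auto
  then show ?thesis by (simp add: S_def)
qed

text \<open>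
  The hypothesis says that the \<open>m * m\<close> blocks \<open>W\<^sub>i\<^sub>j\<close> of \<open>W\<close> satisfy
  \<open>W\<^sub>j\<^sub>b\<^sup>\<dagger> W\<^sub>i\<^sub>a = \<delta>\<^sub>i\<^sub>a \<delta>\<^sub>j\<^sub>b \<one>\<close>. Hence \<open>W\<^sub>i\<^sub>a = 0\<close> for \<open>i \<noteq> a\<close>, and expanding
  \<open>(W\<^sub>i\<^sub>i - W\<^sub>j\<^sub>j)\<^sup>\<dagger> (W\<^sub>i\<^sub>i - W\<^sub>j\<^sub>j) = 0\<close> shows that the diagonal blocks coincide.
\<close>
lemma one_tensor_unitary_if_block_relations:
  assumes W: "W \<in> carrier_mat (m * n) (m * n)"
    and rel: "\<And>i j a b l l'. i < m \<Longrightarrow> j < m \<Longrightarrow> a < m \<Longrightarrow> b < m \<Longrightarrow> l < n \<Longrightarrow> l' < n \<Longrightarrow>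
      (\<Sum>k<n. W $$ (i * n + k, a * n + l) * cnj (W $$ (j * n + k, b * n + l')))
        = (if i = a \<and> j = b \<and> l = l' then 1 else 0)"
  shows "\<exists>\<Phi> \<in> unitary_mats n. W = 1\<^sub>m m \<Otimes> \<Phi>"
\<comment> \<open>The witness is taken from a diagonal block of \<open>W\<close>, and there is one
  only if \<open>m > 0\<close>. For \<open>m = 0\<close> the matrix \<open>W\<close> is empty and
  the identity serves as \<open>\<Phi>\<close>.\<close>
proof (cases "m = 0")
  case True
  have "mat_adjoint (1\<^sub>m n) = (1\<^sub>m n :: complex mat)"
    by (rule eq_matI) (auto simp: mat_adjoint_def mat_of_rows_def)
  then have "1\<^sub>m n \<in> unitary_mats n" by (simp add: unitary_mats_def)
  moreover have "W = 1\<^sub>m m \<Otimes> 1\<^sub>m n"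
    using W True by (intro eq_matI) (auto simp: tensor_mat_def)
  ultimately show ?thesis by blast
next
  case False
  \<comment> \<open>This is the block of \<open>W\<close> at \<open>(0, 0)\<close>, because the pair
    \<open>(0, k)\<close> has index \<open>k\<close>.\<close>
  define \<Phi> where "\<Phi> = mat n n (\<lambda>(k, l). W $$ (k, l))"
  have \<Phi>: "\<Phi> \<in> carrier_mat n n" by (simp add: \<Phi>_def)
  note \<Phi>' = mat_adjoint_carrier[OF \<Phi>]
  have zero_if: "f k = 0" if "(\<Sum>k<n. f k * cnj (f k)) = 0" "k < n" for f :: "nat \<Rightarrow> complex" and k
  proof -
    have "complex_of_real (\<Sum>k<n. (cmod (f k))\<^sup>2) = 0"
      using that(1) by (simp add: complex_norm_square del: of_real_power)
    then have "(\<Sum>k<n. (cmod (f k))\<^sup>2) = 0" by (simp only: of_real_eq_0_iff)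
    then show ?thesis using that(2) by (simp add: sum_nonneg_eq_0_iff)
  qed
  have "mat_adjoint \<Phi> * \<Phi> = 1\<^sub>m n"
  proof (rule eq_matI)
    fix i j
    assume "i < dim_row (1\<^sub>m n :: complex mat)" "j < dim_col (1\<^sub>m n :: complex mat)"
    \<comment> \<open>With all block indices 0, the relations say that the columns of
      \<open>\<Phi>\<close> are orthonormal.\<close>
    then show "(mat_adjoint \<Phi> * \<Phi>) $$ (i, j) = 1\<^sub>m n $$ (i, j)"
      using \<Phi> \<Phi>' rel[of 0 0 0 0 j i] False
      by (auto simp: scalar_prod_def atLeast0LessThan \<Phi>_def mult.commute)
  qed (use \<Phi> \<Phi>' in auto)
  moreover from this have "\<Phi> * mat_adjoint \<Phi> = 1\<^sub>m n"
    using mat_mult_left_right_inverse[OF \<Phi>' \<Phi>] by blast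
  ultimately have "\<Phi> \<in> unitary_mats n"
    using \<Phi> by (simp add: unitary_mats_def)
  moreover have "W = 1\<^sub>m m \<Otimes> \<Phi>"
  proof (rule mat_eq_tensorI[OF W])
    show "1\<^sub>m m \<Otimes> \<Phi> \<in> carrier_mat (m * n) (m * n)" using \<Phi> by simp
    fix i k a l
    assume *: "i < m" "k < n" "a < m" "l < n"
    have "W $$ (i * n + k, a * n + l) = (if i = a then W $$ (k, l) else 0)"
    proof (cases "i = a")
      case True
      \<comment> \<open>This is the difference of the \<open>l\<close>-th columns of the diagonal
        blocks \<open>i\<close> and 0. Each of the four sums in its squared norm equals 1 by
        \<open>rel\<close>, so the total is \<open>1 - 1 - 1 + 1 = 0\<close>.\<close>
      let ?f = "\<lambda>k. W $$ (i * n + k, i * n + l) - W $$ (0 * n + k, 0 * n + l)"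
      have "(\<Sum>k<n. ?f k * cnj (?f k)) = 0"
        using rel[of i i i i l l] rel[of i 0 i 0 l l] rel[of 0 i 0 i l l] rel[of 0 0 0 0 l l] * False
        by (simp add: algebra_simps sum.distrib sum_subtractf)
      from zero_if[OF this \<open>k < n\<close>] show ?thesis using True by simp
    next
      case False
      then show ?thesis
        using zero_if[OF _ \<open>k < n\<close>, of "\<lambda>k. W $$ (i * n + k, a * n + l)"] rel[of i i a a l l] * by simp
    qed
    moreover have "\<Phi> $$ (k, l) = W $$ (k, l)"
      using * by (simp add: \<Phi>_def)
    ultimately show "W $$ (i * n + k, a * n + l) = (1\<^sub>m m \<Otimes> \<Phi>) $$ (i * n + k, a * n + l)"
      using * by (simp add: tensor_mat_index[OF one_carrier_mat \<Phi>])
  qed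
  ultimately show ?thesis by blast
qed

section \<open>Matrix units and the structure of \<open>U V\<^sup>\<dagger>\<close>\<close>

lemma partial_trace_outer_prod_unit_vec:
  assumes "i < m" "j < m" "a < m" "b < m" "l < n" "l' < n"
  shows "partial_trace m n
      (outer_prod (unit_vec (m * n) (a * n + l)) (unit_vec (m * n) (b * n + l'))) $$ (i, j)
    = (if i = a \<and> j = b \<and> l = l' then 1 else 0)"
proof -
  have "partial_trace m n
      (outer_prod (unit_vec (m * n) (a * n + l)) (unit_vec (m * n) (b * n + l'))) $$ (i, j)
    = (\<Sum>k<n. unit_vec (m * n) (a * n + l) $ (i * n + k) *
        cnj (unit_vec (m * n) (b * n + l') $ (j * n + k)))"
    using assms by (simp add: partial_trace_def outer_prod_def tensor_index_less del: index_unit_vec(1))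
  \<comment> \<open>The matrix unit here is
    \<open>E\<^sub>a\<^sub>b \<otimes> E\<^sub>l\<^sub>l\<^sub>'\<close>; its second factor has
    trace 1 if \<open>l = l'\<close> and 0 otherwise, and the only candidate term is
    \<open>k = l\<close>.\<close>
  also have "\<dots> = (\<Sum>k<n. if k = l then (if i = a \<and> j = b \<and> l = l' then 1 else 0) else 0)"
    using assms by (intro sum.cong refl) (auto simp: tensor_index_less tensor_index_eq_iff)
  finally show ?thesis using assms by simp
qed

lemma mult_mat_unit_vec:
  fixes A :: "'a :: semiring_1 mat"
  assumes "A \<in> carrier_mat m n" "c < n"
  shows "A *\<^sub>v unit_vec n c = col A c"
  using assms by (intro eq_vecI) (auto simp: scalar_prod_right_unit)

lemma partial_trace_conj_eq_imp_one_tensor: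
  assumes U: "U \<in> unitary_mats (m * n)" and V: "V \<in> unitary_mats (m * n)"
    and eq: "\<And>\<rho>. \<rho> \<in> density_mats (m * n) \<Longrightarrow>
      partial_trace m n (U * \<rho> * mat_adjoint U) = partial_trace m n (V * \<rho> * mat_adjoint V)"
  shows "\<exists>\<Phi> \<in> unitary_mats n. U = (1\<^sub>m m \<Otimes> \<Phi>) * V"
proof -
  let ?d = "m * n"
  have Uc: "U \<in> carrier_mat ?d ?d" and Vc: "V \<in> carrier_mat ?d ?d"
    and V1: "mat_adjoint V * V = 1\<^sub>m ?d" "V * mat_adjoint V = 1\<^sub>m ?d"
    using U V by (auto simp: unitary_mats_def)
  note V'c = mat_adjoint_carrier[OF Vc]
  define W where "W = U * mat_adjoint V"
  have W: "W \<in> carrier_mat ?d ?d"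
    unfolding W_def by (rule mult_carrier_mat[OF Uc V'c])
  have "(\<Sum>k<n. W $$ (i * n + k, a * n + l) * cnj (W $$ (j * n + k, b * n + l')))
      = (if i = a \<and> j = b \<and> l = l' then 1 else 0)"
    if *: "i < m" "j < m" "a < m" "b < m" "l < n" "l' < n" for i j a b l l'
  proof -
    define p where "p = a * n + l"
    define q where "q = b * n + l'"
    have pq: "p < ?d" "q < ?d"
      using * by (auto simp: p_def q_def tensor_index_less)
    \<comment> \<open>\<open>V\<close> sends these vectors to the basis vectors \<open>p\<close> and
      \<open>q\<close>, and \<open>U\<close> sends them to the columns \<open>p\<close> and
      \<open>q\<close> of \<open>W\<close>. The hypothesis thus equates the partial trace built from
      two columns of \<open>W\<close> with that of a matrix unit.\<close>
    let ?u = "mat_adjoint V *\<^sub>v unit_vec ?d p" and ?v = "mat_adjoint V *\<^sub>v unit_vec ?d q"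
    have uv: "?u \<in> carrier_vec ?d" "?v \<in> carrier_vec ?d"
      using V'c by auto
    have "U *\<^sub>v (mat_adjoint V *\<^sub>v unit_vec ?d r) = col W r" if "r < ?d" for r
      using that mult_mat_unit_vec[OF W that] assoc_mult_mat_vec[OF Uc V'c, of "unit_vec ?d r"]
      by (simp add: W_def)
    moreover have "V *\<^sub>v (mat_adjoint V *\<^sub>v unit_vec ?d r) = unit_vec ?d r" for r
      using assoc_mult_mat_vec[OF Vc V'c, of "unit_vec ?d r"] by (simp add: V1)
    ultimately have "partial_trace m n (outer_prod (col W p) (col W q))
        = partial_trace m n (outer_prod (unit_vec ?d p) (unit_vec ?d q))"
      using partial_trace_conj_outer_prod[OF Uc Vc eq uv] pq
      by (simp add: outer_prod_conj[OF Uc uv] outer_prod_conj[OF Vc uv])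
    then have "partial_trace m n (outer_prod (col W p) (col W q)) $$ (i, j)
        = (if i = a \<and> j = b \<and> l = l' then 1 else 0)"
      using partial_trace_outer_prod_unit_vec[OF *] by (simp add: p_def q_def)
    moreover have "partial_trace m n (outer_prod (col W p) (col W q)) $$ (i, j)
        = (\<Sum>k<n. W $$ (i * n + k, p) * cnj (W $$ (j * n + k, q)))"
      using * W pq by (auto simp: partial_trace_def outer_prod_def tensor_index_less)
    ultimately show ?thesis by (simp add: p_def q_def)
  qed
  from one_tensor_unitary_if_block_relations[OF W this]
  obtain \<Phi> where "\<Phi> \<in> unitary_mats n" "W = 1\<^sub>m m \<Otimes> \<Phi>" by auto
  \<comment> \<open>Here \<open>V\<^sup>\<dagger> V = 1\<close> is used, whereas the computation
    with basis vectors used \<open>V V\<^sup>\<dagger> = 1\<close>.\<close>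
  moreover have "W * V = U"
    using assoc_mult_mat[OF Uc V'c Vc] Uc by (simp add: W_def V1)
  ultimately show ?thesis by auto
qed

theorem theorem1:
  fixes ds de :: nat and U V :: "complex mat"
  assumes "U \<in> unitary_mats (ds * de)" and "V \<in> unitary_mats (ds * de)"
  shows "(\<forall>\<rho> \<in> density_mats (ds * de).
            partial_trace ds de (U * \<rho> * mat_adjoint U) = partial_trace ds de (V * \<rho> * mat_adjoint V))
         \<longleftrightarrow> (\<exists>\<Phi> \<in> unitary_mats de. U = (1\<^sub>m ds \<Otimes> \<Phi>) * V)"
proof
  assume "\<forall>\<rho> \<in> density_mats (ds * de).
    partial_trace ds de (U * \<rho> * mat_adjoint U) = partial_trace ds de (V * \<rho> * mat_adjoint V)"
  then show "\<exists>\<Phi> \<in> unitary_mats de. U = (1\<^sub>m ds \<Otimes> \<Phi>) * V"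
    using partial_trace_conj_eq_imp_one_tensor[OF assms] by blast
next
  assume "\<exists>\<Phi> \<in> unitary_mats de. U = (1\<^sub>m ds \<Otimes> \<Phi>) * V"
  then obtain \<Phi> where \<Phi>: "\<Phi> \<in> unitary_mats de" and U: "U = (1\<^sub>m ds \<Otimes> \<Phi>) * V"
    by blast
  let ?d = "ds * de" and ?T = "1\<^sub>m ds \<Otimes> \<Phi>"
  have V: "V \<in> carrier_mat ?d ?d" and T: "?T \<in> carrier_mat ?d ?d"
    using assms \<Phi> by (auto simp: unitary_mats_def)
  note V' = mat_adjoint_carrier[OF V] and T' = mat_adjoint_carrier[OF T]
  show "\<forall>\<rho> \<in> density_mats ?d.
    partial_trace ds de (U * \<rho> * mat_adjoint U) = partial_trace ds de (V * \<rho> * mat_adjoint V)"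
  proof
    fix \<rho>
    assume "\<rho> \<in> density_mats ?d"
    then have \<rho>: "\<rho> \<in> carrier_mat ?d ?d" by (simp add: density_mats_def)
    \<comment> \<open>Conjugation by \<open>U\<close> is conjugation by \<open>V\<close> followed by
      conjugation by \<open>?T\<close>, and the latter preserves the partial trace.\<close>
    have "U * \<rho> * mat_adjoint U = ?T * (V * \<rho> * mat_adjoint V) * mat_adjoint ?T"
      unfolding U mat_adjoint_mult[OF T V] using T V T' V' \<rho>
      by (simp add: assoc_mult_mat[of _ ?d ?d _ ?d _ ?d] mult_carrier_mat[of _ ?d ?d _ ?d])
    moreover have "V * \<rho> * mat_adjoint V \<in> carrier_mat ?d ?d"
      using V V' \<rho> by (intro mult_carrier_mat)
    ultimately show "partial_trace ds de (U * \<rho> * mat_adjoint U)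
        = partial_trace ds de (V * \<rho> * mat_adjoint V)"
      by (simp add: partial_trace_one_tensor_conj[OF \<Phi>])
  qed
qed

end
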